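(* Let $W\subset S^1$ with $|W|=4$, and suppose $R(W)$ holds, i.e., there exists $w_0\in W$ such that $\tau_{w_0}(W\setminus\{w_0\})\cap W=\emptyset$. Then $P(W)$ holds.
   Context: Identify $S^1$ with $\mathbb{R}/\mathbb{Z}$ (so $x\mapsto x+\tfrac12$ is the antipodal map). The group $O(2)$ acts on $S^1$ by translations $\sigma_a(x)=x+a$ and reflections $\tau_a(x)=-x+2a$. A coloring $c:S^1\to\{R,B\}$ is distinguishing if no non-identity $\gamma\in O(2)$ satisfies $c\circ\gamma=c$. For $W\subset S^1$ with trivial pointwise stabilizer in $O(2)$, $P(W)$ holds if every precoloring $c:S^1\setminus W\to\{R,B\}$ extends to a distinguishing coloring of $S^1$. *)

theory Defs
  imports Complex_Main
begin

text \<open>The circle S^1 = R/Z is represented by the canonical representatives [0,1);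
  arithmetic is taken modulo 1 via frac.\<close>

definition S1 :: "real set" where
  "S1 = {x. 0 \<le> x \<and> x < 1}"

definition sigma :: "real \<Rightarrow> real \<Rightarrow> real" where
  "sigma a x = frac (x + a)"

definition tau :: "real \<Rightarrow> real \<Rightarrow> real" where
  "tau a x = frac (2 * a - x)"

definition O2 :: "(real \<Rightarrow> real) set" where
  "O2 = {sigma a | a. a \<in> S1} \<union> {tau a | a. a \<in> S1}"

text \<open>Colorings are functions to bool (True = R, False = B); only values on S1 matter.
  A coloring is distinguishing if no element of O(2) acting non-trivially on S1 preserves it.\<close>
definition distinguishing :: "(real \<Rightarrow> bool) \<Rightarrow> bool" where
  "distinguishing c \<longleftrightarrow>
     (\<forall>\<gamma>\<in>O2. (\<exists>x\<in>S1. \<gamma> x \<noteq> x) \<longrightarrow> (\<exists>x\<in>S1. c (\<gamma> x) \<noteq> c x))"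

definition P :: "real set \<Rightarrow> bool" where
  "P W \<longleftrightarrow> (\<forall>c :: real \<Rightarrow> bool. \<exists>d. (\<forall>x\<in>S1 - W. d x = c x) \<and> distinguishing d)"

definition R :: "real set \<Rightarrow> bool" where
  "R W \<longleftrightarrow> (\<exists>w0\<in>W. tau w0 ` (W - {w0}) \<inter> W = {})"

end

theory Submission
  imports Defs
begin

text \<open>Translate the distinguished point to \<open>0\<close>, so \<open>W = {0, x, y, z}\<close>, and suppose each of the
  16 extensions has a symmetry. If one of them has a period, the color changes caused by the
  symmetry of another extension form a set of at most \<open>2 |B|\<close> points invariant under all periods;
  this forces \<open>x, y, z\<close> to be periods, then all triples in \<open>W\<close> to be symmetric, then
  \<open>W = {0, r, 2r, 4r}\<close> with \<open>7r = 0\<close>, where \<open>{r, 2r, 4r}\<close> is not symmetric.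

  So every extension has exactly one symmetry, a reflection \<open>w \<mapsto> t - w\<close> with axis \<open>t\<close>.
  In each square of extensions obtained by recoloring two points \<open>p, q\<close>, two of the four axes
  coincide, so one of the axes \<open>2p, 2q, p + q\<close> occurs. Applied to the squares in the directions
  \<open>0, p\<close>, this makes almost every extension have, up to the color of \<open>0\<close>, an axis in two of the
  sets \<open>{x, 2x}\<close>, \<open>{y, 2y}\<close>, \<open>{z, 2z}\<close>, and two such axes that are different would be shared by a
  common extension.\<close>

section \<open>Recolorings of an abelian group and their axes\<close>

text \<open>With exclusive or, the extensions of a precoloring form a Boolean cube indexed by the
  subsets of \<open>W\<close>, and successive recolorings combine by symmetric difference.\<close>

definition recolor :: "('a \<Rightarrow> bool) \<Rightarrow> 'a set \<Rightarrow> 'a \<Rightarrow> bool" where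
  "recolor c B x \<longleftrightarrow> c x \<noteq> (x \<in> B)"

definition transl_sym :: "('a::ab_group_add \<Rightarrow> bool) \<Rightarrow> 'a \<Rightarrow> bool" where
  "transl_sym d a \<longleftrightarrow> (\<forall>x. d (x + a) = d x)"

text \<open>The index \<open>t\<close> is the constant sum of two exchanged points, so reflections
  are indexed without halving in the group.\<close>

definition refl_sym :: "('a::ab_group_add \<Rightarrow> bool) \<Rightarrow> 'a \<Rightarrow> bool" where
  "refl_sym d t \<longleftrightarrow> (\<forall>x. d (t - x) = d x)"

definition asymmetric :: "('a::ab_group_add \<Rightarrow> bool) \<Rightarrow> bool" where
  "asymmetric d \<longleftrightarrow> (\<forall>a. a \<noteq> 0 \<longrightarrow> \<not> transl_sym d a) \<and> (\<forall>t. \<not> refl_sym d t)"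

lemma recolor_recolor: "recolor (recolor c A) B = recolor c (sym_diff A B)"
  by (auto simp: recolor_def fun_eq_iff)

lemma recolor_empty [simp]: "recolor c {} = c"
  by (simp add: recolor_def fun_eq_iff)

lemma refl_sym_compose:
  assumes "refl_sym d s" "refl_sym d t"
  shows "transl_sym d (s - t)"
  unfolding transl_sym_def
proof
  fix x
  have "d (s - (t - x)) = d x"
    using assms unfolding refl_sym_def by metis
  then show "d (x + (s - t)) = d x" by (simp add: algebra_simps)
qed

lemma refl_sym_recolor:
  assumes "refl_sym d t" "\<forall>x\<in>D. t - x \<in> D"
  shows "refl_sym (recolor d D) t"
proof -
  have "t - x \<in> D \<longleftrightarrow> x \<in> D" for x
    using assms(2) by (metis diff_diff_eq2 add_diff_cancel_left')
  then show ?thesis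
    using assms(1) by (simp add: refl_sym_def recolor_def)
qed

text \<open>\<open>D\<close> is the set where two colorings with the common axis \<open>t\<close>
  differ, so \<open>t\<close> preserves it.\<close>

lemma refl_sym_recolor_diff:
  assumes "refl_sym d t" "refl_sym (recolor d D) t" "x \<in> D"
  shows "t - x \<in> D"
  using assms unfolding refl_sym_def recolor_def by metis

text \<open>The two products of the reflections \<open>s\<close>, \<open>u\<close>, \<open>v\<close> in the orders \<open>v s u\<close> and \<open>u s v\<close> are
  the same reflection; comparing the color changes they cause at \<open>a\<close> gives the alternatives.\<close>

lemma corner_axes_aux:
  fixes d :: "'a::ab_group_add \<Rightarrow> bool"
  assumes s: "refl_sym d s" and u: "refl_sym (recolor d {a}) u" and v: "refl_sym (recolor d {b}) v"
    and ne: "a \<noteq> b" "u \<noteq> a + a" "s \<noteq> v" "v \<noteq> a + b"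
  shows "a + a = u + v - s \<or> u - s = a - b \<or> a + b = u + v - s"
proof (rule ccontr)
  assume contra: "\<not> ?thesis"
  have S: "d (s - x) = d x" for x using s by (simp add: refl_sym_def)
  have U: "(d (u - x) \<noteq> (u - x = a)) = (d x \<noteq> (x = a))" for x
    using u by (simp add: refl_sym_def recolor_def)
  have V: "(d (v - x) \<noteq> (v - x = b)) = (d x \<noteq> (x = b))" for x
    using v by (simp add: refl_sym_def recolor_def)
  \<comment> \<open>The common image of \<open>a\<close> under both products. Along
    \<open>e1\<close> only the first reflection changes the color, along \<open>e2\<close> none
    does.\<close>
  define e where "e = u + v - s - a"
  have e1: "e = v - (s - (u - a))" and e2: "e = u - (s - (v - a))"
    by (simp_all add: e_def algebra_simps)
  have "u - a \<noteq> a" using ne(2) by (metis diff_add_cancel)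
  then have "d (u - a) \<noteq> d a" using U[of a] by simp
  moreover have "s - (u - a) \<noteq> b" "e \<noteq> b"
    using contra by (auto simp: e_def algebra_simps)
  then have "d e = d (s - (u - a))" using V[of "s - (u - a)"] e1 by simp
  ultimately have 1: "d e \<noteq> d a" using S by simp
  have "v - a \<noteq> b" using ne(4) by (metis diff_add_cancel add.commute)
  then have "d (v - a) = d a" using V[of a] ne(1) by simp
  moreover have "s - (v - a) \<noteq> a" using ne(3) by (auto simp: algebra_simps)
  moreover have "e \<noteq> a" using contra by (auto simp: e_def algebra_simps)
  ultimately have "d e = d a" using U[of "s - (v - a)"] e2 S by simp
  with 1 show False by simp
qed

lemma corner_axes:
  fixes d :: "'a::ab_group_add \<Rightarrow> bool"
  assumes "refl_sym d s" "refl_sym (recolor d {a}) u" "refl_sym (recolor d {b}) v"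
    and "a \<noteq> b" "u \<noteq> a + a" "v \<noteq> b + b" "s \<noteq> u" "s \<noteq> v" "u \<noteq> a + b" "v \<noteq> a + b"
  shows "a + b = u + v - s \<or>
    (a + a = u + v - s \<or> u - s = a - b) \<and> (b + b = u + v - s \<or> v - s = b - a)"
  using corner_axes_aux[of d s a u b v] corner_axes_aux[of d s b v a u] assms
  by (auto simp: add.commute)

text \<open>\<open>corner_axes\<close> is applied at all four corners. If
  \<open>a + a \<noteq> b + b\<close>, the opposite corners \<open>s\<close> and \<open>z\<close>
  both give the sum \<open>a + b\<close>, so \<open>s = z\<close>. Otherwise \<open>b - a\<close>
  has order two and the axes are determined up to it.\<close>

lemma square_axes_distinct:
  fixes d :: "'a::ab_group_add \<Rightarrow> bool"
  assumes s: "refl_sym d s" and u: "refl_sym (recolor d {a}) u"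
    and v: "refl_sym (recolor d {b}) v" and z: "refl_sym (recolor d {a, b}) z"
    and ab: "a \<noteq> b"
    and dist: "s \<noteq> u" "s \<noteq> v" "s \<noteq> z" "u \<noteq> v" "u \<noteq> z" "v \<noteq> z"
    and na: "a + a \<notin> {s, u, v, z}" and nb: "b + b \<notin> {s, u, v, z}"
    and nab: "a + b \<notin> {s, u, v, z}"
  shows False
proof -
  have r1: "recolor (recolor d {a}) {a} = d" "recolor (recolor d {b}) {b} = d"
    "recolor (recolor d {a, b}) {a} = recolor d {b}" "recolor (recolor d {a, b}) {b} = recolor d {a}"
    "recolor (recolor d {a}) {b} = recolor d {a, b}" "recolor (recolor d {b}) {a} = recolor d {a, b}"
    using ab by (auto simp: recolor_def fun_eq_iff)
  have c00: "a + b = u + v - s \<or>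
    (a + a = u + v - s \<or> u - s = a - b) \<and> (b + b = u + v - s \<or> v - s = b - a)"
    using corner_axes[of d s a u b v] s u v ab dist na nb nab by auto
  have c10: "a + b = s + z - u \<or>
    (a + a = s + z - u \<or> s - u = a - b) \<and> (b + b = s + z - u \<or> z - u = b - a)"
    using corner_axes[of "recolor d {a}" u a s b z] r1 s u z ab dist na nb nab by auto
  have c01: "a + b = z + s - v \<or>
    (a + a = z + s - v \<or> z - v = a - b) \<and> (b + b = z + s - v \<or> s - v = b - a)"
    using corner_axes[of "recolor d {b}" v a z b s] r1 s v z ab dist na nb nab by auto
  have c11: "a + b = v + u - z \<or>
    (a + a = v + u - z \<or> v - z = a - b) \<and> (b + b = v + u - z \<or> u - z = b - a)"
    using corner_axes[of "recolor d {a, b}" z a v b u] r1 u v z ab dist na nb nab by auto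
  show False
  proof (cases "a + a = b + b")
    case False
    \<comment> \<open>At the neighboring corner \<open>u\<close> this would force \<open>z\<close>
      to be \<open>a + a\<close>, \<open>a + b\<close> or \<open>s\<close>. The three similar claims
      below work the same way.\<close>
    have "u - s \<noteq> a - b"
    proof
      assume "u - s = a - b"
      then have u': "u = s + a - b" by (simp add: algebra_simps)
      show False using c10 False dist na unfolding u' by (auto simp: algebra_simps)
    qed
    moreover have "v - s \<noteq> b - a"
    proof
      assume "v - s = b - a"
      then have v': "v = s + b - a" by (simp add: algebra_simps)
      show False using c01 False dist nb unfolding v' by (auto simp: algebra_simps)
    qed
    ultimately have "a + b = u + v - s" using c00 False by auto
    moreover have "v - z \<noteq> a - b"
    proof
      assume "v - z = a - b"
      then have v': "v = z + a - b" by (simp add: algebra_simps)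
      show False using c01 False dist na unfolding v' by (auto simp: algebra_simps)
    qed
    moreover have "u - z \<noteq> b - a"
    proof
      assume "u - z = b - a"
      then have u': "u = z + b - a" by (simp add: algebra_simps)
      show False using c10 False dist nb unfolding u' by (auto simp: algebra_simps)
    qed
    ultimately have "u + v - s = v + u - z" using c11 False by auto
    then show False using dist by (simp add: algebra_simps)
  next
    case True
    define h where "h = b - a"
    have b: "b = a + h" by (simp add: h_def)
    have hh: "h + h = 0" using True by (simp add: b algebra_simps)
    have ah: "a - b = h" using hh by (simp add: b minus_unique)
    have ba: "b - a = h" by (simp add: b)
    have m: "a + b = a + a + h" "b + b = a + a" using True by (simp_all add: b algebra_simps)
    \<comment> \<open>Both \<open>a - b\<close> and \<open>b - a\<close> equal \<open>h\<close>, so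
      the difference alternatives at one corner cannot hold together: they would equate two
      axes.\<close>
    have s0: "u + v - s = a + a \<or> u + v - s = a + a + h"
      using c00 dist(4) m unfolding ah ba by (metis diff_add_cancel)
    have s1: "v + u - z = a + a \<or> v + u - z = a + a + h"
      using c11 dist(4) m unfolding ah ba by (metis diff_add_cancel)
    have s2: "s + z - u = a + a \<or> s + z - u = a + a + h"
      using c10 dist(3) m unfolding ah ba by (metis diff_add_cancel)
    have s3: "z + s - v = a + a \<or> z + s - v = a + a + h"
      using c01 dist(3) m unfolding ah ba by (metis diff_add_cancel)
    have two: "g - g' \<in> {0, h, - h}"
      if "g = a + a \<or> g = a + a + h" "g' = a + a \<or> g' = a + a + h" for g g'
      using that by auto
    have "(u + v - s) - (v + u - z) = z - s" "(s + z - u) - (z + s - v) = v - u"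
      by (simp_all add: algebra_simps)
    then have "z - s \<in> {0, h, - h}" "v - u \<in> {0, h, - h}"
      using two[OF s0 s1] two[OF s2 s3] by simp_all
    moreover have "- h = h" using hh by (simp add: minus_unique)
    ultimately have zs: "z = s + h" and vu: "v = u + h"
      using dist by (auto simp: algebra_simps)
    \<comment> \<open>Applying \<open>s\<close> then \<open>z\<close>, or \<open>u\<close> then
      \<open>v\<close>, takes \<open>a\<close> to \<open>b\<close>. The first route gives
      \<open>b\<close> the opposite color of \<open>a\<close>, the second the same color.\<close>
    have "d (s - a) = d a" using s by (simp add: refl_sym_def)
    moreover have "s - a \<notin> {a, b}" "u - a \<notin> {a, b}" using na nab by (auto simp: diff_eq_eq add.commute)
    moreover have "recolor d {a, b} (z - (s - a)) = recolor d {a, b} (s - a)"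
      "recolor d {a} (u - a) = recolor d {a} a"
      "recolor d {b} (v - (u - a)) = recolor d {b} (u - a)"
      using u v z by (simp_all add: refl_sym_def)
    moreover have "z - (s - a) = b" "v - (u - a) = b" by (simp_all add: zs vu b)
    ultimately show False by (auto simp: recolor_def)
  qed
qed

section \<open>Extensions with a period\<close>

definition motion :: "('a::ab_group_add \<Rightarrow> 'a) \<Rightarrow> bool" where
  "motion g \<longleftrightarrow> (\<exists>a. a \<noteq> 0 \<and> g = (\<lambda>w. w + a)) \<or> (\<exists>t. g = (\<lambda>w. t - w))"

lemma motion_cases [consumes 1, case_names translation reflection]:
  assumes "motion g"
  obtains a where "a \<noteq> 0" "g = (\<lambda>w. w + a)" | t where "g = (\<lambda>w. t - w)"
  using assms by (auto simp: motion_def)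

lemma not_asymmetricE:
  assumes "\<not> asymmetric d"
  obtains g where "motion g" "\<And>w. d (g w) = d w"
  using assms unfolding asymmetric_def transl_sym_def refl_sym_def motion_def by auto

lemma transl_sym_minus: "transl_sym d k \<Longrightarrow> transl_sym d (- k)"
  unfolding transl_sym_def by (metis add.assoc add.left_inverse add.right_neutral)

lemma transl_sym_add: "transl_sym d k \<Longrightarrow> transl_sym d l \<Longrightarrow> transl_sym d (k + l)"
  unfolding transl_sym_def by (metis add.assoc)

lemma inj_motion: "motion g \<Longrightarrow> inj g"
  by (erule motion_cases) (simp_all add: inj_def)

lemma motion_period:
  assumes "motion g" "transl_sym d k"
  shows "d (g (w + k)) = d (g w)"
  using assms(1)
proof (cases rule: motion_cases)
  case (translation a)
  then have "g (w + k) = g w + k" by (simp add: algebra_simps)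
  then show ?thesis using assms(2) by (simp add: transl_sym_def)
next
  case (reflection t)
  then have "g (w + k) = g w + - k" by (simp add: algebra_simps)
  then show ?thesis using transl_sym_minus[OF assms(2)] by (simp only: transl_sym_def)
qed

section \<open>The defect of a set under a motion\<close>

definition defect :: "('a \<Rightarrow> 'a) \<Rightarrow> 'a set \<Rightarrow> 'a set" where
  "defect g B = {w. (g w \<in> B) \<noteq> (w \<in> B)}"

text \<open>If \<open>g\<close> preserves \<open>d\<close> recolored on \<open>B\<close>, then \<open>defect g B\<close> is where \<open>d \<circ> g\<close> differs from
  \<open>d\<close>, so it inherits the periods of \<open>d\<close>.\<close>

lemma defect_period:
  assumes "motion g" "\<And>w. recolor d B (g w) = recolor d B w" "transl_sym d k" "w \<in> defect g B"
  shows "w + k \<in> defect g B"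
proof -
  have "v \<in> defect g B \<longleftrightarrow> d (g v) \<noteq> d v" for v
    using assms(2)[of v] by (auto simp: recolor_def defect_def)
  moreover have "d (w + k) = d w" using assms(3) by (simp add: transl_sym_def)
  ultimately show ?thesis using assms(4) motion_period[OF assms(1,3)] by simp
qed

lemma vimage_motion:
  assumes "motion g" "finite B"
  shows "finite (g -` B)" "card (g -` B) \<le> card B"
  using inj_motion[OF assms(1)] assms(2) card_vimage_inj_on_le[of g UNIV B]
  by (simp_all add: finite_vimageI)

lemma defect_card:
  assumes "motion g" "finite B"
  shows "finite (defect g B)" "card (defect g B) \<le> 2 * card B"
proof -
  have sub: "defect g B \<subseteq> B \<union> g -` B" by (auto simp: defect_def)
  note v = vimage_motion[OF assms]
  show "finite (defect g B)" using sub v(1) assms(2) by (meson finite_UnI finite_subset)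
  have "card (defect g B) \<le> card (B \<union> g -` B)"
    using sub v(1) assms(2) by (intro card_mono) auto
  also have "\<dots> \<le> card B + card (g -` B)" by (rule card_Un_le)
  finally show "card (defect g B) \<le> 2 * card B" using v(2) by simp
qed

text \<open>A point of the defect brings along its translates by all of \<open>S\<close>, which are
  too many.\<close>

lemma defect_empty:
  assumes "motion g" "\<And>w. recolor d B (g w) = recolor d B w" "finite B"
    and "\<And>k. k \<in> S \<Longrightarrow> transl_sym d k" "card (defect g B) < card S"
  shows "defect g B = {}"
proof (rule ccontr)
  assume "defect g B \<noteq> {}"
  then obtain w where w: "w \<in> defect g B" by blast
  have "(+) w ` S \<subseteq> defect g B"
    using defect_period[OF assms(1,2) assms(4) w] by auto
  then have "card ((+) w ` S) \<le> card (defect g B)"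
    using defect_card(1)[OF assms(1,3)] by (rule card_mono[rotated])
  then show False using assms(5) by (simp add: card_image)
qed

text \<open>A counterexample with the distinguished point moved to \<open>0\<close>.
  \<open>add_nonzero\<close> is the hypothesis \<open>R\<close>: negation maps none of
  \<open>x, y, z\<close> into the set. \<open>involution_unique\<close> is the property of the
  circle that 1/2 is its only element of order two.\<close>

locale symmetric_recolorings =
  fixes c :: "'a::ab_group_add \<Rightarrow> bool" and x y z :: 'a
  assumes distinct: "distinct [0, x, y, z]"
    and add_nonzero: "p \<in> {x, y, z} \<Longrightarrow> q \<in> {x, y, z} \<Longrightarrow> p + q \<noteq> 0"
    and involution_unique: "u + u = 0 \<Longrightarrow> v + v = 0 \<Longrightarrow> u = 0 \<or> v = 0 \<or> u = (v :: 'a)"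
    and symmetric: "B \<subseteq> {0, x, y, z} \<Longrightarrow> \<not> asymmetric (recolor c B)"
begin

text \<open>Doubling is at most two-to-one, by \<open>involution_unique\<close>.\<close>

lemma doubles_differ:
  assumes "p \<in> {x, y, z}" "q \<in> {x, y, z}" "r \<in> {x, y, z}" "p \<noteq> q" "p \<noteq> r" "q \<noteq> r"
  shows "p + p \<noteq> q + q \<or> p + p \<noteq> r + r"
proof (rule ccontr)
  assume "\<not> ?thesis"
  then have "(p - q) + (p - q) = 0" "(p - r) + (p - r) = 0" by (auto simp: algebra_simps)
  then show False using involution_unique[of "p - q" "p - r"] assms by auto
qed

text \<open>A symmetry of \<open>c\<close> recolored at \<open>p\<close> alone must fix
  \<open>p\<close>: otherwise it would take \<open>p + a\<close> to \<open>p\<close>, whose new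
  color is opposite to that of \<open>p + a\<close>. So it is the reflection about \<open>p\<close>,
  which survives undoing the recoloring.\<close>

lemma refl_sym_double:
  assumes "transl_sym c a" "a \<noteq> 0" "p \<in> {0, x, y, z}"
  shows "refl_sym c (p + p)"
proof -
  obtain g where g: "motion g" "\<And>w. recolor c {p} (g w) = recolor c {p} w"
    using symmetric[of "{p}"] assms(3) not_asymmetricE by blast
  have "g p = p"
  proof (rule ccontr)
    assume "g p \<noteq> p"
    then have "p \<in> defect g {p}" by (simp add: defect_def)
    then have "p + a \<in> defect g {p}" by (rule defect_period[OF g assms(1)])
    then have "g (p + a) = p" using assms(2) by (auto simp: defect_def)
    then have "(\<not> c p) = c (p + a)" using g(2)[of "p + a"] assms(2) by (simp add: recolor_def)
    then show False using assms(1) by (simp add: transl_sym_def)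
  qed
  with g(1) have "g = (\<lambda>w. p + p - w)"
    by (cases rule: motion_cases) (auto simp: diff_eq_eq)
  then have "refl_sym (recolor c {p}) (p + p)" using g(2) by (simp add: refl_sym_def)
  then have "refl_sym (recolor (recolor c {p}) {p}) (p + p)" by (rule refl_sym_recolor) simp
  then show ?thesis by (simp add: recolor_recolor)
qed

lemma transl_sym_point:
  assumes "transl_sym c a" "a \<noteq> 0" and p: "p \<in> {x, y, z}"
  shows "transl_sym c p"
proof -
  note refl = refl_sym_double[OF assms(1,2)]
  have tr: "transl_sym c (q + q)" if "q \<in> {0, x, y, z}" for q
    using refl_sym_compose[OF refl[OF that] refl[of 0]] by simp
  have "\<exists>q\<in>{x, y, z}. \<exists>r\<in>{x, y, z}. q + q \<noteq> r + r"
    using doubles_differ[of x y z] distinct by auto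
  then obtain q r where qr: "q \<in> {x, y, z}" "r \<in> {x, y, z}" "q + q \<noteq> r + r" by blast
  \<comment> \<open>Composing the axes \<open>q + q\<close> and \<open>r + r\<close> with the axis
    \<open>0\<close> yields periods. The three elements of \<open>S\<close> act on a defect of at
    most four points.\<close>
  define S where "S = {0, q + q, r + r}"
  have S: "card S = 3" "finite S"
    using qr add_nonzero[of q q] add_nonzero[of r r] by (auto simp: S_def)
  have S_tr: "transl_sym c k" if "k \<in> S" for k
    using that tr[of 0] tr[of q] tr[of r] qr by (auto simp: S_def)
  have p0: "p \<noteq> 0" "p + p \<noteq> 0" using p distinct add_nonzero[of p p] by auto
  obtain g where g: "motion g" "\<And>w. recolor c {0, p} (g w) = recolor c {0, p} w"
    using symmetric[of "{0, p}"] p not_asymmetricE by blast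
  let ?e = "defect g {0, p}"
  have e4: "finite ?e" "card ?e \<le> 4" using defect_card[OF g(1), of "{0, p}"] p0 by auto
  show ?thesis
  proof (cases "0 \<in> ?e \<and> p \<in> ?e")
    case True
    have "0 + k \<in> ?e" "p + k \<in> ?e" if "k \<in> S" for k
      using True defect_period[OF g S_tr[OF that]] by blast+
    \<comment> \<open>Six points do not fit into four, so the two translates of \<open>S\<close>
      meet and \<open>p\<close> is a difference of periods.\<close>
    then have "S \<union> (+) p ` S \<subseteq> ?e" by auto
    then have "card (S \<union> (+) p ` S) \<le> 4"
      using card_mono[OF e4(1)] e4(2) order_trans by blast
    then have "S \<inter> (+) p ` S \<noteq> {}"
      using S card_Un_disjoint[of S "(+) p ` S"] by (auto simp: card_image)
    then obtain k l where "k \<in> S" "l \<in> S" "k = p + l" by auto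
    then have "p = k + - l" by simp
    then show ?thesis
      using S_tr \<open>k \<in> S\<close> \<open>l \<in> S\<close> transl_sym_add transl_sym_minus by metis
  next
    case False
    then obtain q q' where q: "q \<notin> ?e" "{0, p} = {q, q'}" by (metis insert_commute)
    then have gq: "q \<in> g -` {0, p}" by (auto simp: defect_def)
    \<comment> \<open>One of the two points is mapped into \<open>{0, p}\<close>, so it is lost from
      the set and from its preimage alike. At most two points remain, fewer than \<open>S\<close>
      has.\<close>
    have sub: "?e \<subseteq> insert q' (g -` {0, p} - {q})" using q by (auto simp: defect_def)
    have fin: "finite (g -` {0, p})" "card (g -` {0, p}) \<le> 2"
      using vimage_motion[OF g(1), of "{0, p}"] p0 by auto
    have "card ?e \<le> card (insert q' (g -` {0, p} - {q}))"
      using sub fin by (intro card_mono) auto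
    also have "\<dots> \<le> Suc (card (g -` {0, p} - {q}))" by (rule card_insert_le_m1) auto
    also have "\<dots> \<le> 2" using gq fin by (simp add: card_Diff_singleton)
    finally have "?e = {}" using defect_empty[OF g _ S_tr] S by simp
    then have pres: "g w \<in> {0, p} \<longleftrightarrow> w \<in> {0, p}" for w by (auto simp: defect_def)
    from g(1) show ?thesis
    proof (cases rule: motion_cases)
      case (translation a)
      then show ?thesis using pres[of 0] pres[of p] p0 by auto
    next
      case (reflection t)
      then have "t = p" using pres[of 0] pres[of p] p0 by (auto simp: neg_eq_iff_add_eq_0)
      moreover have "refl_sym (recolor c {0, p}) t" using g(2) reflection by (simp add: refl_sym_def)
      then have "refl_sym (recolor (recolor c {0, p}) {0, p}) t"
        by (rule refl_sym_recolor) (use pres reflection in auto)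
      ultimately have "refl_sym c p" by (simp add: recolor_recolor)
      then show ?thesis using refl_sym_compose[OF _ refl[of 0]] by fastforce
    qed
  qed
qed

text \<open>The seven periods \<open>0\<close>, \<plusminus>\<open>x\<close>,
  \<plusminus>\<open>y\<close>, \<plusminus>\<open>z\<close> outnumber the defect of a triple, which
  has at most six points. Hence every triple in \<open>W\<close> is invariant under a motion, which
  is too rigid.\<close>

lemma no_transl_sym:
  assumes "a \<noteq> 0"
  shows "\<not> transl_sym c a"
proof
  assume "transl_sym c a"
  note tr = transl_sym_point[OF this assms]
  have nz: "0 \<notin> {x, y, z}" using distinct by simp
  define S where "S = {0, x, y, z, - x, - y, - z}"
  have neg: "p \<noteq> - q" if "p \<in> {x, y, z}" "q \<in> {x, y, z}" for p q
    using add_nonzero[OF that] by (metis add.left_inverse)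
  have S: "card S = 7" using distinct neg by (auto simp: S_def)
  have S_tr: "transl_sym c k" if "k \<in> S" for k
  proof -
    have "transl_sym c 0" by (simp add: transl_sym_def)
    then show ?thesis
      using that tr[of x] tr[of y] tr[of z] transl_sym_minus[OF tr[of x]]
        transl_sym_minus[OF tr[of y]] transl_sym_minus[OF tr[of z]]
      unfolding S_def by auto
  qed
  have triple: "\<exists>g. motion g \<and> (\<forall>w. g w \<in> B \<longleftrightarrow> w \<in> B)"
    if B: "B \<subseteq> {0, x, y, z}" "card B = 3" for B
  proof -
    have fin: "finite B" using B(2) card.infinite by force
    obtain g where g: "motion g" "\<And>w. recolor c B (g w) = recolor c B w"
      using symmetric[OF B(1)] not_asymmetricE by blast
    have "card (defect g B) < card S" using defect_card(2)[OF g(1) fin] B(2) S by simp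
    then have "defect g B = {}" using defect_empty[OF g fin S_tr] by blast
    then show ?thesis using g(1) by (auto simp: defect_def)
  qed
  have double: "q = p + p \<or> p = q + q"
    if pq: "p \<in> {x, y, z}" "q \<in> {x, y, z}" "p \<noteq> q" for p q
  proof -
    have pq0: "p \<noteq> 0" "q \<noteq> 0" using pq nz by auto
    obtain g where g: "motion g" and pres: "\<And>w. g w \<in> {0, p, q} \<longleftrightarrow> w \<in> {0, p, q}"
      using triple[of "{0, p, q}"] pq pq0 by auto
    from g show ?thesis
    proof (cases rule: motion_cases)
      case (translation a)
      then have "a = p \<or> a = q" using pres[of 0] by auto
      then show ?thesis using translation pres[of p] pres[of q] pq0 add_nonzero[of p p] add_nonzero[of q q] pq
        by auto
    next
      case (reflection t)
      then have "t \<in> {0, p, q}" using pres[of 0] by auto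
      moreover have "t \<noteq> 0" using reflection pres[of p] pq0 neg[of p p] neg[of q p] pq by auto
      ultimately show ?thesis using reflection pres[of p] pres[of q] pq pq0
        by (auto simp: diff_eq_eq eq_diff_eq)
    qed
  qed
  have card3: "card {x, y, z} = 3" using distinct by simp
  have cycle: False if r: "{x, y, z} = {r, r + r, r + r + (r + r)}" for r
  proof -
    let ?B = "{r, r + r, r + r + (r + r)}"
    have r0: "r \<noteq> 0" "r + r \<noteq> 0" "r + r + (r + r) \<noteq> 0" using nz unfolding r by auto
    have rr: "r + (r + r) \<noteq> 0" using add_nonzero[of r "r + r"] unfolding r by simp
    obtain g where g: "motion g" and pres: "\<And>w. g w \<in> ?B \<longleftrightarrow> w \<in> ?B"
      using triple[of "{x, y, z}"] card3 unfolding r by auto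
    from g show False
    proof (cases rule: motion_cases)
      case (translation a)
      \<comment> \<open>With \<open>a = r\<close> the point 4r, and with \<open>a\<close> = 3r the
        point 2r, is sent to 5r, outside the set.\<close>
      have "a = r \<or> a = r + r + r" using pres[of r] translation by (auto simp: add.assoc)
      moreover have "r + r + (r + r) + r \<notin> ?B" using r0 rr by (auto simp: add.assoc)
      ultimately show False
        using pres[of "r + r + (r + r)"] pres[of "r + r"] translation by (auto simp: add.assoc)
    next
      case (reflection t)
      \<comment> \<open>These are the possible images of \<open>r\<close>. They send 2r to 0, 4r to
        -r and 2r to 3r respectively, all outside the set.\<close>
      have "t = r + r \<or> t = r + r + r \<or> t = r + r + (r + r) + r"
        using pres[of r] reflection by (auto simp: diff_eq_eq)
      then have "t - (r + r) = 0 \<or> t - (r + r + (r + r)) = - r \<or> t - (r + r) = r + r + r"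
        by (auto simp: algebra_simps)
      moreover have "t - (r + r) \<in> ?B" "t - (r + r + (r + r)) \<in> ?B"
        using pres[of "r + r"] pres[of "r + r + (r + r)"] reflection by auto
      moreover have "0 \<notin> ?B" using r0 by auto
      moreover have "- r \<notin> ?B" using r0 rr add_nonzero[of r "r + r + (r + r)"] unfolding r
        by (auto simp: neg_eq_iff_add_eq_0)
      moreover have "r + r + r \<notin> ?B" using r0 by (auto simp: add.assoc)
      ultimately show False by metis
    qed
  qed
  \<comment> \<open>Doubling is single-valued, so no point is the source of two of these three
    relations and they form a directed cycle.\<close>
  have "y = x + x \<or> x = y + y" "z = y + y \<or> y = z + z" "x = z + z \<or> z = x + x"
    using double[of x y] double[of y z] double[of z x] distinct by auto
  then have "{x, y, z} = {x, x + x, x + x + (x + x)} \<or>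
      {x, y, z} = {y, y + y, y + y + (y + y)} \<or>
      {x, y, z} = {z, z + z, z + z + (z + z)}"
    using distinct by auto
  then show False using cycle by blast
qed

section \<open>Axes of the extensions\<close>

abbreviation W :: "'a set" where "W \<equiv> {0, x, y, z}"

definition axis :: "'a set \<Rightarrow> 'a \<Rightarrow> bool" where
  "axis A t \<longleftrightarrow> refl_sym (recolor c A) t"

text \<open>\<open>recolor c A\<close> has the same extensions as \<open>c\<close>, so it satisfies
  the locale assumptions too.\<close>

lemma no_transl_sym_recolor:
  assumes "A \<subseteq> W" "a \<noteq> 0"
  shows "\<not> transl_sym (recolor c A) a"
proof -
  interpret r: symmetric_recolorings "recolor c A" x y z
  proof
    show "\<not> asymmetric (recolor (recolor c A) B)" if "B \<subseteq> {0, x, y, z}" for B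
      unfolding recolor_recolor by (rule symmetric) (use assms(1) that in blast)
  qed (use distinct add_nonzero involution_unique in blast)+
  show ?thesis using assms(2) by (rule r.no_transl_sym)
qed

lemma axis_exists:
  assumes "A \<subseteq> W"
  shows "\<exists>t. axis A t"
  using symmetric[OF assms] no_transl_sym_recolor[OF assms] by (auto simp: asymmetric_def axis_def)

lemma axis_unique:
  assumes "A \<subseteq> W" "axis A s" "axis A t"
  shows "s = t"
  using assms refl_sym_compose no_transl_sym_recolor unfolding axis_def
  by (metis right_minus_eq)

lemma axis_sym_diff:
  assumes "axis A t" "\<forall>w\<in>D. t - w \<in> D"
  shows "axis (sym_diff A D) t"
  using refl_sym_recolor[of "recolor c A" t D] assms by (simp add: axis_def recolor_recolor)

lemma axis_difference:
  assumes "axis A t" "axis B t" "w \<in> sym_diff A B"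
  shows "t - w \<in> sym_diff A B"
proof -
  have "sym_diff A (sym_diff A B) = B" by blast
  then have "refl_sym (recolor (recolor c A) (sym_diff A B)) t"
    using assms(2) by (simp only: axis_def recolor_recolor)
  with assms(1,3) show ?thesis
    unfolding axis_def by (metis refl_sym_recolor_diff)
qed

lemma axis_flip: "axis A (p + p) \<Longrightarrow> axis (sym_diff A {p}) (p + p)"
  by (rule axis_sym_diff) simp_all

lemma axis_swap: "axis A (p + q) \<Longrightarrow> axis (sym_diff A {p, q}) (p + q)"
  by (rule axis_sym_diff) auto

text \<open>By \<open>axis_flip\<close> and \<open>axis_swap\<close> it suffices to name one corner
  of each pair carrying the same special axis. If none occurs, no two corners share an axis, since
  it would preserve their difference and thus be special.\<close>

lemma square_axes:
  assumes A: "A \<subseteq> W" and pq: "p \<in> W" "q \<in> W" "p \<noteq> q"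
  shows "axis A (p + p) \<or> axis (sym_diff A {q}) (p + p) \<or>
    axis A (q + q) \<or> axis (sym_diff A {p}) (q + q) \<or>
    axis A (p + q) \<or> axis (sym_diff A {p}) (p + q)"
proof (rule ccontr)
  assume neg: "\<not> ?thesis"
  let ?p = "sym_diff A {p}" and ?q = "sym_diff A {q}" and ?pq = "sym_diff A {p, q}"
  have sub: "?p \<subseteq> W" "?q \<subseteq> W" "?pq \<subseteq> W" using A pq by auto
  obtain s u v t where s: "axis A s" and u: "axis ?p u" and v: "axis ?q v" and t: "axis ?pq t"
    using axis_exists A sub by metis
  have sd: "sym_diff ?p {p} = A" "sym_diff ?pq {p} = ?q" "sym_diff ?q {q} = A"
    "sym_diff ?pq {q} = ?p" "sym_diff ?q {p, q} = ?p" "sym_diff ?pq {p, q} = A"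
    using pq(3) by auto
  have dd: "sym_diff A ?p = {p}" "sym_diff A ?q = {q}" "sym_diff A ?pq = {p, q}"
    "sym_diff ?p ?q = {p, q}" "sym_diff ?p ?pq = {q}" "sym_diff ?q ?pq = {p}"
    using pq(3) by auto
  have na: "p + p \<notin> {s, u, v, t}"
    using neg s u v t axis_flip[of ?p p] axis_flip[of ?pq p] unfolding sd by auto
  have nb: "q + q \<notin> {s, u, v, t}"
    using neg s u v t axis_flip[of ?q q] axis_flip[of ?pq q] unfolding sd by auto
  have nab: "p + q \<notin> {s, u, v, t}"
    using neg s u v t axis_swap[of ?q p q] axis_swap[of ?pq p q] unfolding sd by auto
  have "s \<noteq> u" using axis_difference[of A s ?p p] s u na unfolding dd by (auto simp: diff_eq_eq)
  moreover have "s \<noteq> v" using axis_difference[of A s ?q q] s v nb unfolding dd by (auto simp: diff_eq_eq)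
  moreover have "s \<noteq> t" using axis_difference[of A s ?pq p] s t na nab unfolding dd
    by (auto simp: diff_eq_eq add.commute)
  moreover have "u \<noteq> v" using axis_difference[of ?p u ?q p] u v na nab unfolding dd
    by (auto simp: diff_eq_eq add.commute)
  moreover have "u \<noteq> t" using axis_difference[of ?p u ?pq q] u t nb unfolding dd by (auto simp: diff_eq_eq)
  moreover have "v \<noteq> t" using axis_difference[of ?q v ?pq p] v t na unfolding dd by (auto simp: diff_eq_eq)
  ultimately show False
    using square_axes_distinct[of "recolor c A" s p u q v t] s u v t pq(3) na nb nab
    by (simp add: axis_def recolor_recolor)
qed

text \<open>The difference of the two sets is closed under negation, which takes no nonzero point of
  \<open>W\<close> into \<open>W\<close>.\<close>

lemma axis_zero_unique:
  assumes "A \<subseteq> W" "B \<subseteq> W" "axis A 0" "axis B 0"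
  shows "sym_diff A B \<subseteq> {0}"
proof
  fix w assume w: "w \<in> sym_diff A B"
  have "- w \<in> sym_diff A B" using axis_difference[OF assms(3,4) w] by simp
  then have "w \<in> W" "- w \<in> W" using w assms(1,2) by blast+
  then show "w \<in> {0}" using add_nonzero[of w "- w"] by auto
qed

lemma axis_in_direction:
  assumes "A \<subseteq> W" "p \<in> {x, y, z}" "\<not> axis A 0" "\<not> axis (sym_diff A {p}) 0"
  shows "\<exists>C\<in>{A, sym_diff A {0}}. \<exists>t\<in>{p, p + p}. axis C t"
  using square_axes[of A 0 p] assms distinct by auto

text \<open>Two axes whose invariant subsets of \<open>W\<close> together generate all subsets would be axes of
  a common recoloring.\<close>

lemma axes_collide:
  assumes "A \<subseteq> W" "B \<subseteq> W" "axis A s" "axis B t"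
    and "D \<subseteq> W" "\<forall>w\<in>D. s - w \<in> D" "\<forall>w\<in>E. t - w \<in> E" "sym_diff A B = sym_diff D E"
  shows "s = t"
proof -
  have "sym_diff A D = sym_diff B E" using assms(8) by blast
  moreover have "axis (sym_diff A D) s" "axis (sym_diff B E) t"
    using axis_sym_diff assms by blast+
  moreover have "sym_diff A D \<subseteq> W" using assms(1,5) by blast
  ultimately show ?thesis using axis_unique by metis
qed

section \<open>Configurations of axes that cannot occur\<close>

lemma enumeration:
  assumes "{x, y, z} = {p, q, r}"
  shows "W = {0, p, q, r}" "distinct [0, p, q, r]"
proof -
  show "W = {0, p, q, r}" using assms by auto
  have "card {p, q, r} = 3" using distinct unfolding assms[symmetric] by simp
  moreover have "0 \<notin> {p, q, r}" using distinct unfolding assms[symmetric] by simp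
  ultimately show "distinct [0, p, q, r]" by (auto simp: card_insert_if split: if_splits)
qed

text \<open>Axis \<open>p\<close> preserves \<open>{0, p}\<close> and \<open>{q}\<close>; axis
  \<open>q\<close> preserves \<open>{0, q}\<close> and \<open>{r}\<close>. These four sets generate
  all subsets of \<open>W\<close>.\<close>

lemma axes_collide_chain:
  assumes A: "A \<subseteq> W" "B \<subseteq> W" "axis A p" "axis B q"
    and pqr: "{x, y, z} = {p, q, r}" "p = q + q" "q = r + r"
  shows False
proof -
  let ?E = "sym_diff A B"
  note W = enumeration(1)[OF pqr(1)] and d = enumeration(2)[OF pqr(1)]
  \<comment> \<open>\<open>D\<close> and \<open>F\<close> solve \<open>?E = sym_diff D F\<close>:
    \<open>p\<close> decides on \<open>{0, p}\<close>, then \<open>0\<close> on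
    \<open>{0, q}\<close>, then \<open>q\<close> on \<open>{q}\<close>.\<close>
  define D where "D = (if p \<in> ?E then {0, p} else {}) \<union>
    (if (q \<in> ?E) = ((0 \<in> ?E) \<noteq> (p \<in> ?E)) then {} else {q})"
  define F where "F = (if r \<in> ?E then {r} else {}) \<union>
    (if (0 \<in> ?E) = (p \<in> ?E) then {} else {0, q})"
  have "p = q"
  proof (rule axes_collide[OF A])
    show "D \<subseteq> W" unfolding W by (auto simp: D_def)
    show "\<forall>w\<in>D. p - w \<in> D" using pqr(2) by (auto simp: D_def)
    show "\<forall>w\<in>F. q - w \<in> F" using pqr(3) by (auto simp: F_def)
    have "?E \<subseteq> {0, p, q, r}" using A W by blast
    moreover have "D \<subseteq> {0, p, q, r}" "F \<subseteq> {0, p, q, r}" by (auto simp: D_def F_def)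
    moreover have "w \<in> ?E \<longleftrightarrow> w \<in> sym_diff D F" if "w \<in> {0, p, q, r}" for w
      using that d unfolding D_def F_def by auto
    ultimately show "?E = sym_diff D F" by blast
  qed
  then show False using d by simp
qed

text \<open>Here the generating sets are \<open>{p}\<close> and \<open>{q}\<close> for the axis
  \<open>p + p\<close>, and \<open>{0, p}\<close> and \<open>{r}\<close> for the axis
  \<open>p\<close>.\<close>

lemma axes_collide_doubles:
  assumes A: "A \<subseteq> W" "B \<subseteq> W" "axis A (p + p)" "axis B p"
    and pqr: "{x, y, z} = {p, q, r}" "p + p = q + q" "p = r + r"
  shows False
proof -
  let ?E = "sym_diff A B"
  note W = enumeration(1)[OF pqr(1)] and d = enumeration(2)[OF pqr(1)]
  define D where "D = (if q \<in> ?E then {q} else {}) \<union>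
    (if (0 \<in> ?E) = (p \<in> ?E) then {} else {p})"
  define F where "F = (if r \<in> ?E then {r} else {}) \<union> (if 0 \<in> ?E then {0, p} else {})"
  have "p + p = p"
  proof (rule axes_collide[OF A])
    show "D \<subseteq> W" unfolding W by (auto simp: D_def)
    have "p + p - q = q" using pqr(2) by simp
    then show "\<forall>w\<in>D. p + p - w \<in> D" by (simp add: D_def)
    have "p - r = r" using pqr(3) by simp
    then show "\<forall>w\<in>F. p - w \<in> F" by (simp add: F_def)
    have "?E \<subseteq> {0, p, q, r}" using A W by blast
    moreover have "D \<subseteq> {0, p, q, r}" "F \<subseteq> {0, p, q, r}" by (auto simp: D_def F_def)
    moreover have "w \<in> ?E \<longleftrightarrow> w \<in> sym_diff D F" if "w \<in> {0, p, q, r}" for w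
      using that d unfolding D_def F_def by auto
    ultimately show "?E = sym_diff D F" by blast
  qed
  then show False using d by simp
qed

text \<open>Axis \<open>r\<close> exchanges \<open>0\<close> and \<open>r\<close>, so it disappears
  when exactly one of them is recolored. The squares in directions \<open>p, q\<close> after
  recoloring \<open>0\<close> and after recoloring \<open>r\<close> must then both have axis
  \<open>p + q\<close>, but their difference is not invariant under it.\<close>

lemma no_triple_axis:
  assumes A: "A \<subseteq> W" "axis A r" and pqr: "{x, y, z} = {p, q, r}" "r = p + p" "r = q + q"
  shows False
proof -
  note W = enumeration(1)[OF pqr(1)] and d = enumeration(2)[OF pqr(1)]
  have r: "(r \<in> sym_diff A B) = (0 \<in> sym_diff A B)" if "axis B r" for B
    using axis_difference[OF A(2) that, of r] axis_difference[OF A(2) that, of 0] by auto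
  have diag: "axis C (p + q) \<or> axis (sym_diff C {p}) (p + q)"
    if C: "C = sym_diff A {w}" "w \<in> {0, r}" for C w
  proof -
    have "\<not> axis B r" if "B \<in> {C, sym_diff C {p}, sym_diff C {q}}" for B
      using r[of B] that C d by auto
    moreover have "C \<subseteq> W" using C A W by auto
    ultimately show ?thesis using square_axes[of C p q] W d pqr by auto
  qed
  obtain E where E: "E \<in> {sym_diff A {0}, sym_diff (sym_diff A {0}) {p}}" "axis E (p + q)"
    using diag[of "sym_diff A {0}" 0] by auto
  obtain F where F: "F \<in> {sym_diff A {r}, sym_diff (sym_diff A {r}) {p}}" "axis F (p + q)"
    using diag[of "sym_diff A {r}" r] by auto
  have "0 \<in> sym_diff E F" "q \<notin> sym_diff E F" "sym_diff E F \<subseteq> {0, p, r}"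
    using E(1) F(1) d by auto
  moreover have "p \<notin> sym_diff E F"
    using axis_difference[OF E(2) F(2), of p] \<open>q \<notin> sym_diff E F\<close> by auto
  moreover have "p + q \<in> sym_diff E F"
    using axis_difference[OF E(2) F(2), of 0] \<open>0 \<in> sym_diff E F\<close> by simp
  ultimately have "p + q = 0 \<or> p + q = r \<or> p + q = p" by blast
  moreover have "p + q \<noteq> 0" using add_nonzero[of p q] unfolding pqr(1) by simp
  moreover have "p + q \<noteq> r" using pqr(2) d by auto
  ultimately show False using d by simp
qed


text \<open>Pigeonhole: each of the three points supplies an axis at \<open>A\<close> or at
  \<open>sym_diff A {0}\<close>, so two points share a coloring, and by uniqueness an axis.\<close>

lemma coincident_axis:
  assumes A: "A \<subseteq> W" "\<not> axis A 0" "\<And>p. p \<in> {x, y, z} \<Longrightarrow> \<not> axis (sym_diff A {p}) 0"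
  obtains C t p q where "C \<in> {A, sym_diff A {0}}" "axis C t" "p \<in> {x, y, z}" "q \<in> {x, y, z}"
    "p \<noteq> q" "t = q + q" "t = p \<or> t = p + p"
proof -
  let ?G = "\<lambda>C t p q. C \<in> {A, sym_diff A {0}} \<and> axis C t \<and> p \<in> {x, y, z} \<and> q \<in> {x, y, z} \<and>
    p \<noteq> q \<and> t = q + q \<and> (t = p \<or> t = p + p)"
  have ex: "\<exists>C\<in>{A, sym_diff A {0}}. \<exists>t\<in>{p, p + p}. axis C t" if "p \<in> {x, y, z}" for p
    using axis_in_direction A that by blast
  obtain C t C' t' C'' t'' where
    C: "C \<in> {A, sym_diff A {0}}" "t \<in> {x, x + x}" "axis C t" and
    C': "C' \<in> {A, sym_diff A {0}}" "t' \<in> {y, y + y}" "axis C' t'" and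
    C'': "C'' \<in> {A, sym_diff A {0}}" "t'' \<in> {z, z + z}" "axis C'' t''"
    using ex[of x] ex[of y] ex[of z] by blast
  have merge: "\<exists>C t p q. ?G C t p q"
    if "C \<in> {A, sym_diff A {0}}" "axis C t" "axis C t'" "t \<in> {p, p + p}" "t' \<in> {q, q + q}"
      "p \<in> {x, y, z}" "q \<in> {x, y, z}" "p \<noteq> q" for C t t' p q
  proof -
    have "C \<subseteq> W" using that(1) A(1) by auto
    then have "t = t'" using that(2,3) axis_unique by blast
    then have "?G C t p q \<or> ?G C t q p" using that by auto
    then show ?thesis by blast
  qed
  have "C = C' \<or> C = C'' \<or> C' = C''" using C(1) C'(1) C''(1) by auto
  then have "\<exists>C t p q. ?G C t p q"
    using merge[of C t t' x y] merge[of C t t'' x z] merge[of C' t' t'' y z] C C' C'' distinct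
    by auto
  then show thesis using that by blast
qed

lemma inconsistent: False
proof -
  obtain B where B: "B \<subseteq> W" "\<not> axis B 0" "\<And>p. p \<in> {x, y, z} \<Longrightarrow> \<not> axis (sym_diff B {p}) 0"
    "\<And>p q. p \<in> {x, y, z} \<Longrightarrow> q \<in> {x, y, z} \<Longrightarrow> \<not> axis (sym_diff (sym_diff B {p}) {q}) 0"
  proof (cases "\<exists>A\<subseteq>W. axis A 0")
    case True
    then obtain A where A: "A \<subseteq> W" "axis A 0" by blast
    \<comment> \<open>Colorings with axis \<open>0\<close> agree with \<open>A\<close> off
      \<open>0\<close>. \<open>B\<close> differs from \<open>A\<close> at three other points, too
      many to undo with two recolorings.\<close>
    define B where "B = sym_diff A {x, y, z}"
    have zero: "sym_diff A E \<subseteq> {0}" if "E \<subseteq> W" "axis E 0" for E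
      using axis_zero_unique[OF A(1) that(1) A(2) that(2)] .
    have BW: "B \<subseteq> W" using A(1) by (auto simp: B_def)
    have sub: "sym_diff B {p} \<subseteq> W" "sym_diff (sym_diff B {p}) {q} \<subseteq> W"
      if "p \<in> {x, y, z}" "q \<in> {x, y, z}" for p q
      using BW that by auto
    have w: "\<exists>w\<in>{x, y, z}. w \<noteq> p \<and> w \<noteq> q" for p q
      using distinct by (metis distinct_length_2_or_more insertCI)
    show thesis
    proof (rule that[of B])
      show "\<not> axis B 0" using zero[OF BW] distinct by (auto simp: B_def)
      show "\<not> axis (sym_diff (sym_diff B {p}) {q}) 0"
        if "p \<in> {x, y, z}" "q \<in> {x, y, z}" for p q
      proof
        assume "axis (sym_diff (sym_diff B {p}) {q}) 0"
        then have "sym_diff A (sym_diff (sym_diff B {p}) {q}) \<subseteq> {0}" using zero sub(2)[OF that] by blast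
        moreover obtain w where "w \<in> {x, y, z}" "w \<noteq> p" "w \<noteq> q" using w by blast
        ultimately have "w = 0" unfolding B_def by blast
        then show False using \<open>w \<in> {x, y, z}\<close> distinct by auto
      qed
      show "\<not> axis (sym_diff B {p}) 0" if "p \<in> {x, y, z}" for p
      proof
        assume "axis (sym_diff B {p}) 0"
        then have "sym_diff A (sym_diff B {p}) \<subseteq> {0}" using zero sub(1)[OF that that] by blast
        moreover obtain w where "w \<in> {x, y, z}" "w \<noteq> p" using w by blast
        ultimately have "w = 0" unfolding B_def by blast
        then show False using \<open>w \<in> {x, y, z}\<close> distinct by auto
      qed
    qed (rule BW)
  next
    case False
    then have none: "\<not> axis A 0" if "A \<subseteq> W" for A using that by blast
    show thesis by (rule that[of "{}"]; (intro none)?; blast)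
  qed
  obtain C t p q where C: "C \<in> {B, sym_diff B {0}}" "axis C t" and
    pq: "p \<in> {x, y, z}" "q \<in> {x, y, z}" "p \<noteq> q" and t: "t = q + q" "t = p \<or> t = p + p"
    by (rule coincident_axis[OF B(1-3)])
  obtain r where pqr: "{x, y, z} = {p, q, r}" using pq by auto
  note d = enumeration(2)[OF pqr]
  have r: "r \<in> {x, y, z}" unfolding pqr by simp
  have "sym_diff B {r} \<subseteq> W" using B(1) r by auto
  then obtain C' t' p' q' where
    C': "C' \<in> {sym_diff B {r}, sym_diff (sym_diff B {r}) {0}}" "axis C' t'" and
    pq': "p' \<in> {x, y, z}" "q' \<in> {x, y, z}" "p' \<noteq> q'" and t': "t' = q' + q'" "t' = p' \<or> t' = p' + p'"
    by (rule coincident_axis[OF _ B(3)[OF r] B(4)[OF r]])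
  have sub: "C \<subseteq> W" "C' \<subseteq> W" using C(1) C'(1) B(1) r by auto
  have perms: "{x, y, z} = {q, r, p}" "{x, y, z} = {r, p, q}" "{x, y, z} = {p, r, q}" "{x, y, z} = {q, p, r}"
    using pqr by auto
  have self: "p \<noteq> p + p" "q \<noteq> q + q" "r \<noteq> r + r" using d by auto
  have dd: "\<not> (p + p = q + q \<and> p + p = r + r)" using doubles_differ[of p q r] d unfolding pqr by auto
  show False
  proof (cases "t = t'")
    case True
    \<comment> \<open>A common axis preserves a difference that is \<open>{r}\<close> or
      \<open>{0, r}\<close>, so it also equals \<open>r\<close> or \<open>r + r\<close>. Three
      coincidences at one axis are excluded.\<close>
    have D: "r \<in> sym_diff C C'" "sym_diff C C' \<subseteq> {0, r}" using C(1) C'(1) d by auto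
    have "t - r \<in> sym_diff C C'" using axis_difference[OF C(2) _ D(1)] C'(2) True by simp
    then have "t - r = 0 \<or> t - r = r" using D(2) by blast
    then have "t = r \<or> t = r + r" by (auto simp: diff_eq_eq)
    then show False
      using t d dd C(2) no_triple_axis[OF sub(1) _ perms(1)] no_triple_axis[OF sub(1) _ pqr]
      by (metis distinct_length_2_or_more)
  next
    case False
    have pq_eq: "\<not> (p = q + q \<and> q = p + p)"
    proof
      assume "p = q + q \<and> q = p + p"
      then have "p + 0 = p + (p + q)" by (metis add.assoc add.right_neutral)
      then show False using add_nonzero[OF pq(1,2)] by simp
    qed
    \<comment> \<open>Each placement yields \<open>t = t'\<close>, the relations refuted by
      \<open>pq_eq\<close>, or a pair of axes excluded by a collision lemma.\<close>
    consider "p' = p" "q' = q" | "p' = q" "q' = p" | "p' = q" "q' = r" | "p' = r" "q' = q"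
      | "p' = p" "q' = r" | "p' = r" "q' = p"
      using pq' unfolding pqr by auto
    then show False
    proof cases
      case 1
      then show False using t t' False self by metis
    next
      case 2
      then show False using t t' False self pq_eq by metis
    next
      case 3
      then show False using t t' False self dd C(2) C'(2)
          axes_collide_chain[OF sub _ _ pqr] axes_collide_doubles[OF sub _ _ perms(4)] by metis
    next
      case 4
      then show False using t t' False self dd by metis
    next
      case 5
      then show False using t t' False self dd C(2) C'(2)
          axes_collide_doubles[OF sub _ _ pqr] axes_collide_doubles[OF sub(2,1) _ _ perms(3)] by metis
    next
      case 6
      then show False using t t' False self dd C(2) C'(2)
          axes_collide_chain[OF sub(2,1) _ _ perms(2)] axes_collide_doubles[OF sub(2,1) _ _ perms(3)] by metis
    qed
  qed
qed

end
section \<open>The circle\<close>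

quotient_type circle = real / "\<lambda>a b. a - b \<in> \<int>"
proof (rule equivpI)
  show "reflp (\<lambda>a b :: real. a - b \<in> \<int>)" by (simp add: reflp_def)
  show "symp (\<lambda>a b :: real. a - b \<in> \<int>)" by (auto simp: symp_def dest: Ints_minus)
  show "transp (\<lambda>a b :: real. a - b \<in> \<int>)" by (auto simp: transp_def dest: Ints_add)
qed

instantiation circle :: ab_group_add
begin

lift_definition zero_circle :: circle is 0 .

lift_definition plus_circle :: "circle \<Rightarrow> circle \<Rightarrow> circle" is "(+)"
  by (metis Ints_add add_diff_add)

lift_definition uminus_circle :: "circle \<Rightarrow> circle" is uminus
  by (metis Ints_minus minus_diff_minus)

lift_definition minus_circle :: "circle \<Rightarrow> circle \<Rightarrow> circle" is "(-)"
proof -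
  fix a b a' b' :: real
  assume "a - b \<in> \<int>" "a' - b' \<in> \<int>"
  then have "(a - b) - (a' - b') \<in> \<int>" by (rule Ints_diff)
  then show "a - a' - (b - b') \<in> \<int>" by (simp add: algebra_simps)
qed

instance by standard (transfer, simp)+

end

section \<open>Passage between the circle and its representatives in [0,1)\<close>

lift_definition circle_of :: "real \<Rightarrow> circle" is "\<lambda>a. a" .

lift_definition to_S1 :: "circle \<Rightarrow> real" is frac
proof -
  fix a b :: real
  assume "a - b \<in> \<int>"
  then obtain k where "a - b = of_int k" by (elim Ints_cases)
  then have "a = b + of_int k" by simp
  then show "frac a = frac b" by (simp add: frac_def)
qed

lemma circle_of_eq_0_iff: "circle_of a = 0 \<longleftrightarrow> a \<in> \<int>"
  by transfer simp

lemma circle_of_add: "circle_of (a + b) = circle_of a + circle_of b"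
  by transfer simp

lemma circle_of_diff: "circle_of (a - b) = circle_of a - circle_of b"
  by transfer simp

lemma circle_of_double: "circle_of (2 * a) = circle_of a + circle_of a"
  by (simp only: mult_2 circle_of_add)

lemma circle_of_frac [simp]: "circle_of (frac a) = circle_of a"
  by transfer (simp add: frac_def)

lemma to_S1_circle_of [simp]: "to_S1 (circle_of a) = frac a"
  by transfer simp

lemma circle_of_to_S1 [simp]: "circle_of (to_S1 u) = u"
  by transfer (simp add: frac_def)

lemma to_S1_in_S1 [simp]: "to_S1 u \<in> S1"
  by transfer (simp add: S1_def frac_lt_1)

lemma frac_S1 [simp]: "a \<in> S1 \<Longrightarrow> frac a = a"
  by (simp add: S1_def frac_eq)

lemma inj_on_circle_of: "inj_on circle_of S1"
  by (metis frac_S1 inj_onI to_S1_circle_of)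

text \<open>If the integers \<open>a + a\<close> and \<open>b + b\<close> are both odd, their
  difference is even.\<close>

lemma circle_involution_unique:
  fixes u v :: circle
  assumes "u + u = 0" "v + v = 0"
  shows "u = 0 \<or> v = 0 \<or> u = v"
  using assms
proof transfer
  fix a b :: real
  assume "a + a - 0 \<in> \<int>" "b + b - 0 \<in> \<int>"
  then obtain m n where m: "a + a = of_int m" and n: "b + b = of_int n" by (auto elim!: Ints_cases)
  have half: "g \<in> \<int>" if "g + g = of_int k" "even k" for g :: real and k :: int
  proof -
    from \<open>even k\<close> obtain l where "k = 2 * l" by blast
    then have "g = of_int l" using that(1) by simp
    then show ?thesis by simp
  qed
  have "(a - b) + (a - b) = of_int (m - n)" using m n by simp
  then show "a - 0 \<in> \<int> \<or> b - 0 \<in> \<int> \<or> a - b \<in> \<int>"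
    using half[OF m] half[OF n] half[of "a - b" "m - n"] by auto
qed

section \<open>Transfer of the group argument to the circle\<close>

theorem theorem2p2p2:
  fixes W :: "real set"
  assumes "W \<subseteq> S1" and "card W = 4" and "R W"
  shows "P W"
  unfolding P_def
proof
  fix c :: "real \<Rightarrow> bool"
  obtain w where w: "w \<in> W" "tau w ` (W - {w}) \<inter> W = {}" using assms(3) by (auto simp: R_def)
  have "card (W - {w}) = 3" using assms(2) w(1) by simp
  then obtain w1 w2 w3 where w123: "W - {w} = {w1, w2, w3}" "w1 \<noteq> w2" "w1 \<noteq> w3" "w2 \<noteq> w3"
    by (auto simp: card_3_iff)
  have W: "W = {w, w1, w2, w3}" and "w \<notin> {w1, w2, w3}" using w123 w(1) by blast+
  \<comment> \<open>\<open>pt\<close> moves \<open>w\<close> to \<open>0\<close>; the argument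
    \<open>u + circle_of w\<close> in \<open>c'\<close> below moves it back.\<close>
  define pt where "pt a = circle_of a - circle_of w" for a
  have pt_inj: "a = b" if "pt a = pt b" "a \<in> S1" "b \<in> S1" for a b
    using that inj_on_circle_of by (auto simp: pt_def dest: inj_onD)
  define c' where "c' u = c (to_S1 (u + circle_of w))" for u
  have "\<exists>B\<subseteq>{0, pt w1, pt w2, pt w3}. asymmetric (recolor c' B)"
  proof (rule ccontr)
    assume contra: "\<not> ?thesis"
    have "symmetric_recolorings c' (pt w1) (pt w2) (pt w3)"
    proof
      have "pt w = 0" by (simp add: pt_def)
      then show "distinct [0, pt w1, pt w2, pt w3]"
        using pt_inj W w123 \<open>w \<notin> {w1, w2, w3}\<close> assms(1)
        by (metis distinct.simps distinct_singleton insert_iff insert_subset list.set)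
      fix p q assume "p \<in> {pt w1, pt w2, pt w3}" "q \<in> {pt w1, pt w2, pt w3}"
      then obtain a b where ab: "a \<in> W - {w}" "b \<in> W" "p = pt a" "q = pt b" using W w123 by auto
      show "p + q \<noteq> 0"
      proof
        assume "p + q = 0"
        \<comment> \<open>The sum vanishes only if \<open>tau w\<close> takes \<open>a\<close> to
          \<open>b\<close>, which the choice of \<open>w\<close> forbids.\<close>
        then have "circle_of b = circle_of w + circle_of w - circle_of a" by (simp add: ab pt_def algebra_simps)
        also have "\<dots> = circle_of (2 * w - a)" by (simp only: circle_of_diff circle_of_double)
        finally have "to_S1 (circle_of b) = to_S1 (circle_of (2 * w - a))" by simp
        then have "b = tau w a" using ab assms(1) by (auto simp: tau_def)
        then show False using w(2) ab by blast
      qed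
    qed (use circle_involution_unique contra in blast)+
    then show False by (rule symmetric_recolorings.inconsistent)
  qed
  then obtain B where B: "B \<subseteq> {0, pt w1, pt w2, pt w3}" "asymmetric (recolor c' B)" by blast
  define d where "d a = recolor c' B (pt a)" for a
  have lift: "d (to_S1 (u + circle_of w)) = recolor c' B u" for u by (simp add: d_def pt_def)
  have "d a = c a" if a: "a \<in> S1 - W" for a
  proof -
    have "pt a \<notin> pt ` W" using a pt_inj assms(1) by blast
    moreover have "{0, pt w1, pt w2, pt w3} = pt ` W" by (simp add: W pt_def)
    ultimately have "pt a \<notin> B" using B(1) by blast
    then show ?thesis using a by (simp add: d_def recolor_def c'_def pt_def)
  qed
  moreover have "distinguishing d"
    unfolding distinguishing_def
  proof (intro ballI impI)
    fix g assume g: "g \<in> O2" and moves: "\<exists>a\<in>S1. g a \<noteq> a"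
    show "\<exists>a\<in>S1. d (g a) \<noteq> d a"
    proof (rule ccontr)
      assume "\<not> ?thesis"
      then have inv: "d (g (to_S1 (u + circle_of w))) = recolor c' B u" for u
        using lift by simp
      from g consider a where "a \<in> S1" "g = sigma a" | a where "g = tau a" by (auto simp: O2_def)
      then show False
      proof cases
        case 1
        have "transl_sym (recolor c' B) (circle_of a)"
          unfolding transl_sym_def
        proof
          fix u
          have "pt (g (to_S1 (u + circle_of w))) = u + circle_of a"
            by (simp add: 1 sigma_def pt_def circle_of_add)
          then show "recolor c' B (u + circle_of a) = recolor c' B u"
            using inv[of u] by (simp add: d_def)
        qed
        then have "circle_of a = 0" using B(2) by (auto simp: asymmetric_def)
        then have "a = 0" using 1(1) by (metis frac_S1 frac_eq_0_iff circle_of_eq_0_iff)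
        then show False using moves 1(2) by (auto simp: sigma_def)
      next
        case 2
        \<comment> \<open>\<open>tau a\<close> reflects about \<open>a\<close>, so its axis in
          translated coordinates is twice \<open>pt a\<close>.\<close>
        have "refl_sym (recolor c' B) (pt a + pt a)"
          unfolding refl_sym_def
        proof
          fix u
          have "pt (g (to_S1 (u + circle_of w))) = pt a + pt a - u"
            unfolding 2 tau_def pt_def circle_of_frac circle_of_diff circle_of_double circle_of_to_S1
            by (simp add: algebra_simps)
          then show "recolor c' B (pt a + pt a - u) = recolor c' B u"
            using inv[of u] by (simp add: d_def)
        qed
        then show False using B(2) by (auto simp: asymmetric_def)
      qed
    qed
  qed
  ultimately show "\<exists>d. (\<forall>x\<in>S1 - W. d x = c x) \<and> distinguishing d" by blast
qed
end
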